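(* Let $\mathcal{L}$ be a finite semidistributive lattice with at least two atoms and at least two coatoms, and let $\mathcal{M}$ be a maximal sublattice of $\mathcal{L}$. If there is an element $a\in\mathcal{C}=\mathcal{L}\setminus\mathcal{M}$ that is comparable to every element of $\mathcal{C}$, then $\mathcal{C}$ is an interval of $\mathcal{L}$.
   Context: A lattice is join-semidistributive if $x\vee y=x\vee z$ implies $x\vee(y\wedge z)=x\vee y$ for all $x,y,z$; meet-semidistributive is the dual condition; semidistributive means both. A maximal sublattice is a proper (nonempty) sublattice not contained in any other proper sublattice. An interval is a set of the form $[a,b]=\{c: a\le c\le b\}$. Atoms are the covers of the least element, coatoms the subcovers of the greatest element. *)

theory Defs
  imports Main
begin

class join_semidistrib_lattice = lattice +
  assumes join_semidistrib: "sup x y = sup x z \<Longrightarrow> sup x (inf y z) = sup x y"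

class meet_semidistrib_lattice = lattice +
  assumes meet_semidistrib: "inf x y = inf x z \<Longrightarrow> inf x (sup y z) = inf x y"

class semidistrib_lattice = join_semidistrib_lattice + meet_semidistrib_lattice

context order
begin

definition covers :: "'a \<Rightarrow> 'a \<Rightarrow> bool" where
  "covers y x \<longleftrightarrow> x < y \<and> (\<nexists>z. x < z \<and> z < y)"

definition is_atom :: "'a \<Rightarrow> bool" where
  "is_atom x \<longleftrightarrow> (\<exists>l. (\<forall>w. l \<le> w) \<and> covers x l)"

definition is_coatom :: "'a \<Rightarrow> bool" where
  "is_coatom x \<longleftrightarrow> (\<exists>g. (\<forall>w. w \<le> g) \<and> covers g x)"

definition comparable :: "'a \<Rightarrow> 'a \<Rightarrow> bool" where
  "comparable x y \<longleftrightarrow> x \<le> y \<or> y \<le> x"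

definition is_interval :: "'a set \<Rightarrow> bool" where
  "is_interval S \<longleftrightarrow> (\<exists>u v. S = {u..v})"

end

context lattice
begin

definition sublattice :: "'a set \<Rightarrow> bool" where
  "sublattice S \<longleftrightarrow> S \<noteq> {} \<and> (\<forall>x\<in>S. \<forall>y\<in>S. sup x y \<in> S \<and> inf x y \<in> S)"

definition maximal_sublattice :: "'a set \<Rightarrow> bool" where
  "maximal_sublattice M \<longleftrightarrow> sublattice M \<and> M \<noteq> UNIV \<and>
     \<not> (\<exists>N. sublattice N \<and> N \<noteq> UNIV \<and> M \<subset> N)"

end

end

theory Submission
  imports Defs
begin

text \<open>
  Let \<open>a\<close> be an element of the complement \<open>C\<close> of \<open>M\<close> comparable to all of \<open>C\<close>. If some interval
  \<open>[p, q]\<close> with \<open>p \<le> a \<le> q\<close> is disjoint from \<open>M\<close>, if \<open>p\<close> is join prime in the ideal below \<open>q\<close>, and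
  \<open>q\<close> is meet prime in the filter above \<open>p\<close>, then removing \<open>[p, q]\<close> leaves a proper sublattice
  containing \<open>M\<close>, which therefore equals \<open>M\<close>.

  Join semidistributivity makes \<open>a\<close> a join of elements that are join prime below \<open>a\<close> (its
  canonical joinands), and dually; this gives \<open>[p, q]\<close> disjoint from \<open>M\<close> with both primeness
  properties relative to \<open>a\<close>. If every element of \<open>M\<close> below \<open>q\<close> is below \<open>a\<close>, then \<open>p\<close> is already
  join prime below \<open>q\<close>. Otherwise let \<open>y\<close> be the greatest element of \<open>M\<close> below \<open>q\<close>, and replace \<open>p\<close> by
  the least \<open>w\<close> with \<open>y \<squnion> w = y \<squnion> a\<close>. Every element of \<open>C\<close> is then either above the new \<open>p\<close> or below
  an element of \<open>M\<close> that is below \<open>q\<close>. This condition implies that \<open>p\<close> is join prime below \<open>q\<close>, and it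
  survives enlarging \<open>q\<close>, so that \<open>q\<close> can be treated dually afterwards.
\<close>

context semidistrib_lattice
begin

text \<open>Semidistributivity is self-dual, so instantiating results of this context at the
  opposite order supplies their meet versions.\<close>

lemma dual_semidistrib_lattice: "class.semidistrib_lattice sup (\<ge>) (>) inf"
proof -
  interpret dual: lattice sup "(\<ge>)" "(>)" inf by (rule dual_lattice)
  show ?thesis
    by unfold_locales (rule join_semidistrib meet_semidistrib, assumption)+
qed

section \<open>Canonical joinands in finite lattices\<close>

lemma ex_greatest_if_sup_closed:
  assumes "finite S" "S \<noteq> {}" "\<And>x y. x \<in> S \<Longrightarrow> y \<in> S \<Longrightarrow> sup x y \<in> S"
  shows "\<exists>g\<in>S. \<forall>x\<in>S. x \<le> g"
proof -
  obtain g where g: "g \<in> S" "\<And>x. x \<in> S \<Longrightarrow> g \<le> x \<Longrightarrow> g = x"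
    using finite_has_maximal[OF assms(1,2)] by blast
  have "x \<le> g" if "x \<in> S" for x
    using g(2)[OF assms(3)[OF g(1) that]] by (metis sup_ge1 sup_ge2)
  with g(1) show ?thesis by blast
qed

lemmas ex_least_if_inf_closed =
  semidistrib_lattice.ex_greatest_if_sup_closed[OF dual_semidistrib_lattice]

text \<open>Join semidistributivity makes the solutions of \<open>sup s w = sup s a\<close> closed
  under meets.\<close>

lemma ex_least_joinand:
  assumes "finite (UNIV :: 'a set)"
  shows "\<exists>w. sup s w = sup s a \<and> (\<forall>v. sup s v = sup s a \<longrightarrow> w \<le> v)"
proof -
  let ?S = "{w. sup s w = sup s a}"
  have "\<exists>g\<in>?S. \<forall>x\<in>?S. g \<le> x"
  proof (rule ex_least_if_inf_closed)
    show "finite ?S" by (rule finite_subset[OF subset_UNIV assms])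
    show "?S \<noteq> {}" by blast
    show "inf x y \<in> ?S" if "x \<in> ?S" "y \<in> ?S" for x y
      using that join_semidistrib[of s x y] by simp
  qed
  then show ?thesis by blast
qed

text \<open>Take \<open>s\<close> maximal with \<open>x \<le> s < a\<close> and \<open>p\<close>
  least with \<open>sup s p = a\<close>. Every \<open>u \<le> a\<close> is below \<open>s\<close> or
  has \<open>sup s u = a\<close>, hence \<open>p \<le> u\<close>; so the elements below
  \<open>a\<close> but not above \<open>p\<close> are closed under joins.\<close>

lemma ex_join_prime_below:
  assumes fin: "finite (UNIV :: 'a set)" and "x < a"
  shows "\<exists>p\<le>a. \<not> p \<le> x \<and> (\<forall>u v. u \<le> a \<longrightarrow> v \<le> a \<longrightarrow> p \<le> sup u v \<longrightarrow> p \<le> u \<or> p \<le> v)"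
proof -
  let ?S = "{s. x \<le> s \<and> s < a}"
  have "finite ?S" by (rule finite_subset[OF subset_UNIV fin])
  moreover have "?S \<noteq> {}" using assms(2) by blast
  ultimately obtain s
    where s: "x \<le> s" "s < a" "\<And>r. x \<le> r \<Longrightarrow> r < a \<Longrightarrow> s \<le> r \<Longrightarrow> s = r"
    using finite_has_maximal[of ?S] by blast
  obtain p where p: "sup s p = sup s a" "\<And>v. sup s v = sup s a \<Longrightarrow> p \<le> v"
    using ex_least_joinand[OF fin] by blast
  have sa: "sup s a = a" using s(2) by (simp add: sup_absorb2)
  have ps: "\<not> p \<le> s"
    using p(1) s(2) sa by (metis sup_absorb1 less_irrefl)
  have below: "u \<le> s" if "u \<le> a" "\<not> p \<le> u" for u
  proof (rule ccontr)
    assume "\<not> u \<le> s"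
    moreover have "sup s u \<le> a" using that s(2) by simp
    moreover have "sup s u \<noteq> a" using p(2)[of u] that sa by auto
    ultimately show False
      using s(1) s(3)[of "sup s u"] by (metis le_supI1 order.not_eq_order_implies_strict sup_ge1 sup_ge2)
  qed
  have "p \<le> u \<or> p \<le> v" if "u \<le> a" "v \<le> a" "p \<le> sup u v" for u v
    using below[of u] below[of v] that ps by (meson le_supI order_trans)
  moreover have "p \<le> a" by (rule p(2)) simp
  moreover have "\<not> p \<le> x" using ps s(1) order_trans by blast
  ultimately show ?thesis by blast
qed

lemmas ex_meet_prime_above =
  semidistrib_lattice.ex_join_prime_below[OF dual_semidistrib_lattice]

section \<open>Primeness from covering, and extension of the interval\<close>

lemma join_prime_below_if_covered:
  assumes M: "\<forall>x\<in>M. \<forall>y\<in>M. sup x y \<in> M"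
    and disj: "\<forall>m\<in>M. \<not> (p \<le> m \<and> m \<le> q)"
    and covered: "\<forall>c. c \<notin> M \<longrightarrow> p \<le> c \<or> (\<exists>m\<in>M. c \<le> m \<and> m \<le> q)"
  shows "\<forall>u v. u \<le> q \<longrightarrow> v \<le> q \<longrightarrow> p \<le> sup u v \<longrightarrow> p \<le> u \<or> p \<le> v"
proof (intro allI impI, rule ccontr)
  fix u v
  assume uv: "u \<le> q" "v \<le> q" "p \<le> sup u v" "\<not> (p \<le> u \<or> p \<le> v)"
  \<comment> \<open>If \<open>u\<close> is in \<open>M\<close>, it serves as \<open>m\<close>
    itself; otherwise \<open>covered\<close> applies, as \<open>p \<le> u\<close> fails.\<close>
  obtain m where m: "m \<in> M" "u \<le> m" "m \<le> q" using uv covered by blast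
  obtain n where n: "n \<in> M" "v \<le> n" "n \<le> q" using uv covered by blast
  have "p \<le> sup m n" using uv(3) m(2) n(2) by (meson order_trans sup_mono)
  moreover have "sup m n \<le> q" using m n by simp
  ultimately show False using disj M m(1) n(1) by blast
qed

lemmas meet_prime_above_if_covered =
  semidistrib_lattice.join_prime_below_if_covered[OF dual_semidistrib_lattice]

text \<open>The final disjunction is for later reuse: either \<open>p\<close> is unchanged, so its
  primeness below \<open>a\<close> stays available, or the covering condition holds, which survives
  enlarging \<open>q\<close>.\<close>

lemma ex_join_prime_below_extension:
  assumes fin: "finite (UNIV :: 'a set)"
    and M: "\<forall>x\<in>M. \<forall>y\<in>M. sup x y \<in> M"
    and comp: "\<forall>c. c \<notin> M \<longrightarrow> a \<le> c \<or> c \<le> a"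
    and pq: "p \<le> a" "a \<le> q"
    and disj: "\<forall>m\<in>M. \<not> (p \<le> m \<and> m \<le> q)"
    and prime: "\<forall>u v. u \<le> a \<longrightarrow> v \<le> a \<longrightarrow> p \<le> sup u v \<longrightarrow> p \<le> u \<or> p \<le> v"
  shows "\<exists>p'\<le>p. (\<forall>m\<in>M. \<not> (p' \<le> m \<and> m \<le> q))
    \<and> (\<forall>u v. u \<le> q \<longrightarrow> v \<le> q \<longrightarrow> p' \<le> sup u v \<longrightarrow> p' \<le> u \<or> p' \<le> v)
    \<and> (p' = p \<or> (\<forall>c. c \<notin> M \<longrightarrow> p' \<le> c \<or> (\<exists>m\<in>M. c \<le> m \<and> m \<le> q)))"
proof (cases "\<forall>m\<in>M. m \<le> q \<longrightarrow> m \<le> a")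
  case True
  have "p \<le> u \<or> p \<le> v" if uv: "u \<le> q" "v \<le> q" "p \<le> sup u v" for u v
  proof (rule ccontr)
    assume n: "\<not> (p \<le> u \<or> p \<le> v)"
    then have "\<not> a \<le> u" "\<not> a \<le> v" using pq(1) order_trans by blast+
    then have "u \<le> a" "v \<le> a" using True comp uv by blast+
    then show False using prime uv(3) n by blast
  qed
  then show ?thesis using disj by blast
next
  case False
  let ?S = "{m \<in> M. m \<le> q}"
  have "\<exists>g\<in>?S. \<forall>x\<in>?S. x \<le> g"
  proof (rule ex_greatest_if_sup_closed)
    show "finite ?S" by (rule finite_subset[OF subset_UNIV fin])
    show "?S \<noteq> {}" using False by blast
  qed (use M in auto)
  then obtain y where y: "y \<in> M" "y \<le> q" "\<And>m. m \<in> M \<Longrightarrow> m \<le> q \<Longrightarrow> m \<le> y" by blast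
  have ya: "\<not> y \<le> a"
    using False y(3) by (meson order_trans)
  obtain w where w: "sup y w = sup y a" "\<And>v. sup y v = sup y a \<Longrightarrow> w \<le> v"
    using ex_least_joinand[OF fin] by blast
  \<comment> \<open>The join \<open>sup y c\<close> stays below \<open>q\<close> but not below
    \<open>y\<close>, so it is outside \<open>M\<close>. As \<open>y\<close> is not below
    \<open>a\<close>, comparability forces \<open>a \<le> sup y c\<close>, so \<open>c\<close> is
    one of the joinands that \<open>w\<close> bounds.\<close>
  have above: "w \<le> c" if c: "c \<notin> M" "c \<le> a" "\<not> c \<le> y" for c
  proof -
    have "sup y c \<le> q" using y(2) c(2) pq(2) by (meson le_supI order_trans)
    moreover have "\<not> sup y c \<le> y" using c(3) by simp
    ultimately have "sup y c \<notin> M" using y(3) by blast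
    moreover have "\<not> sup y c \<le> a" using ya by simp
    ultimately have "a \<le> sup y c" using comp by blast
    then have "sup y c = sup y a" using c(2)
      by (meson order.antisym le_supI sup_ge1 sup_mono order_refl)
    then show ?thesis by (rule w(2))
  qed
  have "\<not> p \<le> y" using disj y by blast
  moreover have "p \<notin> M" using disj pq order_trans by blast
  ultimately have "w \<le> p" using above pq(1) by blast
  moreover have disj': "\<forall>m\<in>M. \<not> (w \<le> m \<and> m \<le> q)"
  proof (intro ballI notI)
    fix m assume "m \<in> M" "w \<le> m \<and> m \<le> q"
    then have "w \<le> y" using y(3) order_trans by blast
    then have "a \<le> y" using w(1) by (metis sup_absorb1 sup_ge2)
    then show False using \<open>\<not> p \<le> y\<close> pq(1) order_trans by blast
  qed
  moreover have covered: "\<forall>c. c \<notin> M \<longrightarrow> w \<le> c \<or> (\<exists>m\<in>M. c \<le> m \<and> m \<le> q)"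
  proof (intro allI impI)
    fix c assume c: "c \<notin> M"
    have "w \<le> a" using \<open>w \<le> p\<close> pq(1) by (rule order_trans)
    consider "a \<le> c" | "c \<le> y" | "c \<le> a" "\<not> c \<le> y" using comp c by blast
    then show "w \<le> c \<or> (\<exists>m\<in>M. c \<le> m \<and> m \<le> q)"
    proof cases
      case 1
      with \<open>w \<le> a\<close> have "w \<le> c" by (rule order_trans)
      then show ?thesis ..
    qed (use above c y(1,2) in blast)+
  qed
  ultimately show ?thesis
    using join_prime_below_if_covered[OF M disj' covered] by blast
qed

lemmas ex_meet_prime_above_extension =
  semidistrib_lattice.ex_join_prime_below_extension[OF dual_semidistrib_lattice]

section \<open>A prime interval around \<open>a\<close>\<close>

lemma ex_prime_interval_around:
  assumes fin: "finite (UNIV :: 'a set)"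
    and sup_M: "\<forall>x\<in>M. \<forall>y\<in>M. sup x y \<in> M"
    and inf_M: "\<forall>x\<in>M. \<forall>y\<in>M. inf x y \<in> M"
    and "b \<in> M" "b \<le> a" "t \<in> M" "a \<le> t" "a \<notin> M"
  shows "\<exists>p q. p \<le> a \<and> a \<le> q \<and> (\<forall>m\<in>M. \<not> (p \<le> m \<and> m \<le> q))
    \<and> (\<forall>u v. u \<le> a \<longrightarrow> v \<le> a \<longrightarrow> p \<le> sup u v \<longrightarrow> p \<le> u \<or> p \<le> v)
    \<and> (\<forall>u v. a \<le> u \<longrightarrow> a \<le> v \<longrightarrow> inf u v \<le> q \<longrightarrow> u \<le> q \<or> v \<le> q)"
proof -
  let ?S = "{m \<in> M. m \<le> a}"
  have "\<exists>g\<in>?S. \<forall>x\<in>?S. x \<le> g"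
  proof (rule ex_greatest_if_sup_closed)
    show "finite ?S" by (rule finite_subset[OF subset_UNIV fin])
    show "?S \<noteq> {}" using assms by blast
  qed (use sup_M in auto)
  then obtain y where y: "y \<in> M" "y \<le> a" "\<And>m. m \<in> M \<Longrightarrow> m \<le> a \<Longrightarrow> m \<le> y" by blast
  have "y < a" using y \<open>a \<notin> M\<close> by (metis order.not_eq_order_implies_strict)
  \<comment> \<open>As \<open>y\<close> bounds the elements of \<open>M\<close> below
    \<open>a\<close>, \<open>\<not> p \<le> y\<close> keeps \<open>M\<close> out of the interval
    from \<open>p\<close> to \<open>a\<close>.\<close>
  then obtain p where p: "p \<le> a" "\<not> p \<le> y"
    "\<forall>u v. u \<le> a \<longrightarrow> v \<le> a \<longrightarrow> p \<le> sup u v \<longrightarrow> p \<le> u \<or> p \<le> v"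
    using ex_join_prime_below[OF fin] by blast
  let ?T = "{m \<in> M. p \<le> m}"
  have "\<exists>g\<in>?T. \<forall>x\<in>?T. g \<le> x"
  proof (rule ex_least_if_inf_closed)
    show "finite ?T" by (rule finite_subset[OF subset_UNIV fin])
    show "?T \<noteq> {}" using \<open>t \<in> M\<close> \<open>a \<le> t\<close> p(1) order_trans by blast
  qed (use inf_M in auto)
  then obtain z where z: "z \<in> M" "p \<le> z" "\<And>m. m \<in> M \<Longrightarrow> p \<le> m \<Longrightarrow> z \<le> m" by blast
  have "\<not> z \<le> a" using y(3) z(1,2) p(2) order_trans by blast
  then have "a < sup z a" by (metis order.not_eq_order_implies_strict sup_ge1 sup_ge2)
  \<comment> \<open>An \<open>m \<in> M\<close> between \<open>p\<close> and \<open>q\<close> would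
    give \<open>z \<le> m \<le> q\<close>, hence \<open>sup z a \<le> q\<close>, which this choice
    of \<open>q\<close> excludes.\<close>
  then obtain q where q: "a \<le> q" "\<not> sup z a \<le> q"
    "\<forall>u v. a \<le> u \<longrightarrow> a \<le> v \<longrightarrow> inf u v \<le> q \<longrightarrow> u \<le> q \<or> v \<le> q"
    using ex_meet_prime_above[OF fin] by blast
  have "\<forall>m\<in>M. \<not> (p \<le> m \<and> m \<le> q)"
    using z(3) q(1,2) by (meson le_supI order_trans)
  with p q show ?thesis by blast
qed

lemma ex_prime_interval:
  assumes fin: "finite (UNIV :: 'a set)"
    and sup_M: "\<forall>x\<in>M. \<forall>y\<in>M. sup x y \<in> M"
    and inf_M: "\<forall>x\<in>M. \<forall>y\<in>M. inf x y \<in> M"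
    and bounds: "b \<in> M" "b \<le> a" "t \<in> M" "a \<le> t"
    and a: "a \<notin> M" and comp: "\<forall>c. c \<notin> M \<longrightarrow> a \<le> c \<or> c \<le> a"
  shows "\<exists>p q. p \<le> a \<and> a \<le> q \<and> (\<forall>m\<in>M. \<not> (p \<le> m \<and> m \<le> q))
    \<and> (\<forall>u v. u \<le> q \<longrightarrow> v \<le> q \<longrightarrow> p \<le> sup u v \<longrightarrow> p \<le> u \<or> p \<le> v)
    \<and> (\<forall>u v. p \<le> u \<longrightarrow> p \<le> v \<longrightarrow> inf u v \<le> q \<longrightarrow> u \<le> q \<or> v \<le> q)"
proof -
  let ?disj = "\<lambda>p q. \<forall>m\<in>M. \<not> (p \<le> m \<and> m \<le> q)"
  let ?jp = "\<lambda>p q. \<forall>u v. u \<le> q \<longrightarrow> v \<le> q \<longrightarrow> p \<le> sup u v \<longrightarrow> p \<le> u \<or> p \<le> v"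
  let ?mp = "\<lambda>p q. \<forall>u v. p \<le> u \<longrightarrow> p \<le> v \<longrightarrow> inf u v \<le> q \<longrightarrow> u \<le> q \<or> v \<le> q"
  let ?J = "\<lambda>p q. \<forall>c. c \<notin> M \<longrightarrow> p \<le> c \<or> (\<exists>m\<in>M. c \<le> m \<and> m \<le> q)"
  let ?M = "\<lambda>p q. \<forall>c. c \<notin> M \<longrightarrow> c \<le> q \<or> (\<exists>m\<in>M. m \<le> c \<and> p \<le> m)"
  have jstep: "\<exists>p'\<le>p. ?disj p' q \<and> ?jp p' q \<and> (p' = p \<or> ?J p' q)"
    if "p \<le> a" "a \<le> q" "?disj p q" "?jp p a" for p q
    using ex_join_prime_below_extension[OF fin sup_M comp that] .
  have comp': "\<forall>c. c \<notin> M \<longrightarrow> c \<le> a \<or> a \<le> c" using comp by blast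
  have disj_commute: "?disj p q \<longleftrightarrow> (\<forall>m\<in>M. \<not> (m \<le> q \<and> p \<le> m))" for p q by blast
  have mstep: "\<exists>q'\<ge>q. ?disj p q' \<and> ?mp p q' \<and> (q' = q \<or> ?M p q')"
    if "p \<le> a" "a \<le> q" "?disj p q" "?mp a q" for p q
    using ex_meet_prime_above_extension[OF fin inf_M comp' that(2,1) _ that(4)] that(3)
    unfolding disj_commute .
  have J: "?jp p q" if "?disj p q" "?J p q" for p q
    using join_prime_below_if_covered[OF sup_M that] .
  have M: "?mp p q" if "?disj p q" "?M p q" for p q
    using meet_prime_above_if_covered[OF inf_M _ that(2)] that(1) unfolding disj_commute .
  obtain p q where pq: "p \<le> a" "a \<le> q" "?disj p q" "?jp p a" "?mp a q"
    using ex_prime_interval_around[OF fin sup_M inf_M bounds a] by blast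
  obtain p1 where p1: "p1 \<le> p" "?disj p1 q" "?jp p1 q" "p1 = p \<or> ?J p1 q"
    using jstep[OF pq(1-4)] by blast
  have "p1 \<le> a" using p1(1) pq(1) by (rule order_trans)
  then obtain q1 where q1: "q \<le> q1" "?disj p1 q1" "?mp p1 q1" "q1 = q \<or> ?M p1 q1"
    using mstep[OF _ pq(2) p1(2) pq(5)] by blast
  have "a \<le> q1" using pq(2) q1(1) by (rule order_trans)
  \<comment> \<open>So far \<open>p1\<close> is join prime below \<open>q\<close>, but
    \<open>q1\<close> may be larger.\<close>
  consider "?J p1 q" | "p1 = p" "q1 = q" | "p1 = p" "?M p1 q1" using p1(4) q1(4) by blast
  then show ?thesis
  proof cases
    case 1
    then have "?J p1 q1" using q1(1) by (meson order_trans)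
    then have "?jp p1 q1" by (rule J[OF q1(2)])
    with q1(2,3) \<open>p1 \<le> a\<close> \<open>a \<le> q1\<close> show ?thesis by blast
  next
    case 2
    have "?jp p1 q1" unfolding 2(2) by (rule p1(3))
    with q1(2,3) \<open>p1 \<le> a\<close> \<open>a \<le> q1\<close> show ?thesis by blast
  next
    case 3
    \<comment> \<open>As \<open>p1 = p\<close> is still prime below \<open>a\<close>, the lower end
      can be chosen afresh for \<open>q1\<close>; the dual covering condition survives lowering
      \<open>p\<close> to \<open>p2\<close>.\<close>
    obtain p2 where p2: "p2 \<le> p" "?disj p2 q1" "?jp p2 q1"
      using jstep[OF pq(1) \<open>a \<le> q1\<close> _ pq(4)] q1(2) 3(1) by blast
    have "?M p2 q1" using 3 p2(1) by (meson order_trans)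
    then have "?mp p2 q1" by (rule M[OF p2(2)])
    moreover have "p2 \<le> a" using p2(1) pq(1) by (rule order_trans)
    ultimately show ?thesis using p2 \<open>a \<le> q1\<close> by blast
  qed
qed

end

section \<open>The complement of \<open>M\<close> as an interval\<close>

lemma (in lattice) maximal_sublattice_eqI:
  assumes "maximal_sublattice M" "sublattice N" "M \<subseteq> N" "c \<notin> N"
  shows "N = M"
  using assms unfolding maximal_sublattice_def by blast

theorem theorem5p5:
  fixes M :: "'a :: {finite, semidistrib_lattice} set"
  assumes "card {x :: 'a. is_atom x} \<ge> 2"
    and "card {x :: 'a. is_coatom x} \<ge> 2"
    and "maximal_sublattice M"
    and "\<exists>a \<in> UNIV - M. \<forall>c \<in> UNIV - M. comparable a c"
  shows "is_interval (UNIV - M)"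
proof -
  have M: "\<forall>x\<in>M. \<forall>y\<in>M. sup x y \<in> M" "\<forall>x\<in>M. \<forall>y\<in>M. inf x y \<in> M"
    using assms(3) by (simp_all add: maximal_sublattice_def sublattice_def)
  obtain a where a: "a \<notin> M" "\<forall>c. c \<notin> M \<longrightarrow> a \<le> c \<or> c \<le> a"
    using assms(4) unfolding comparable_def by blast
  obtain b :: 'a where b: "\<And>x. b \<le> x"
    using ex_least_if_inf_closed[of "UNIV :: 'a set"] by auto
  obtain t :: 'a where t: "\<And>x. x \<le> t"
    using ex_greatest_if_sup_closed[of "UNIV :: 'a set"] by auto
  \<comment> \<open>Serves the cases where \<open>M\<close> misses the least or greatest element;
    otherwise \<open>b\<close> and \<open>t\<close> are elements of \<open>M\<close> below and above
    \<open>a\<close>.\<close>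
  have single: "is_interval (UNIV - M)" if "e \<notin> M" "sublattice (insert e M)" for e
  proof -
    have "insert e M = UNIV"
      using maximal_sublattice_eqI[OF assms(3) that(2)] that(1) by blast
    then have "UNIV - M = {e..e}" using that(1) by auto
    then show ?thesis unfolding is_interval_def by blast
  qed
  consider "b \<notin> M" | "t \<notin> M" | "b \<in> M" "t \<in> M" by blast
  then show ?thesis
  proof cases
    case 1
    have "sublattice (insert b M)"
      unfolding sublattice_def using M b by (auto simp: sup_absorb1 sup_absorb2 inf_absorb1 inf_absorb2)
    with 1 show ?thesis by (rule single)
  next
    case 2
    have "sublattice (insert t M)"
      unfolding sublattice_def using M t by (auto simp: sup_absorb1 sup_absorb2 inf_absorb1 inf_absorb2)
    with 2 show ?thesis by (rule single)
  next
    case 3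
    obtain p q where pq: "p \<le> a" "a \<le> q" "\<forall>m\<in>M. \<not> (p \<le> m \<and> m \<le> q)"
      "\<forall>u v. u \<le> q \<longrightarrow> v \<le> q \<longrightarrow> p \<le> sup u v \<longrightarrow> p \<le> u \<or> p \<le> v"
      "\<forall>u v. p \<le> u \<longrightarrow> p \<le> v \<longrightarrow> inf u v \<le> q \<longrightarrow> u \<le> q \<or> v \<le> q"
      using ex_prime_interval[OF finite_UNIV M 3(1) b 3(2) t a] by blast
    have "M \<subseteq> - {p..q}" using pq(3) by auto
    moreover have "sublattice (- {p..q})"
      unfolding sublattice_def
    proof (intro conjI ballI)
      show "- {p..q} \<noteq> {}" using \<open>M \<subseteq> - {p..q}\<close> 3(1) by blast
    next
      fix x y assume xy: "x \<in> - {p..q}" "y \<in> - {p..q}"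
      \<comment> \<open>If \<open>sup x y\<close> were in the interval, \<open>x\<close> and
        \<open>y\<close> would be below \<open>q\<close>, and primeness would put one of them above
        \<open>p\<close>, hence in the interval.\<close>
      show "sup x y \<in> - {p..q}" using xy pq(4) by auto
      show "inf x y \<in> - {p..q}" using xy pq(5) by auto
    qed
    ultimately have "- {p..q} = M"
      using maximal_sublattice_eqI[OF assms(3), of _ a] pq(1,2) by simp
    then have "UNIV - M = {p..q}" by blast
    then show ?thesis unfolding is_interval_def by blast
  qed
qed

end
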